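(* Let $1<p<\infty$. There exists a nontrivial weight $u$ on $\mathbb{R}$ such that the Hardy-Littlewood maximal operator $M$ is bounded from $L^{p}(u)$ to $L^{p}(u)$, i.e. there is a finite constant $C$ with $\|Mf\|_{L^p(u)}\le C\|f\|_{L^p(u)}$ for all $f\in L^p(u)$, but the Hilbert transform $H$ is unbounded from $L^{p}(u)$ to $L^{p}(u)$, i.e. there is no finite constant $C$ with $\|Hf\|_{L^p(u)}\le C\|f\|_{L^p(u)}$ for all $f\in L^p(u)$.
   Context: A weight on $\mathbb{R}$ is a non-negative locally integrable function; it is nontrivial if it is not a.e. zero. Weights are allowed to vanish on sets of positive measure. For a weight $u$, $L^p(u)$ is the set of measurable functions $f$ on $\mathbb{R}$ which are supported on the support $\{u>0\}$ of $u$ (i.e. vanish a.e. where $u=0$) and satisfy $\int |f|^p u\,dx<\infty$; for any measurable $g$ one writes $\|g\|_{L^p(u)}=\left(\int_{\mathbb{R}} |g|^p u\,dx\right)^{1/p}$ (so the values of $Mf$, $Hf$ where $u=0$ play no role). The Hardy-Littlewood maximal function is $Mf(x)=\sup_{Q}\frac{1_Q(x)}{|Q|}\int_Q |f(y)|\,dy$, the supremum being over bounded intervals $Q\subset\mathbb{R}$. The Hilbert transform is $Hf(x)=\mathrm{p.v.}\int_{\mathbb{R}}\frac{f(y)}{y-x}\,dy$. *)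

theory Defs
  imports "HOL-Analysis.Analysis"
begin

definition is_weight :: "(real \<Rightarrow> real) \<Rightarrow> bool" where
  "is_weight u \<longleftrightarrow> (\<forall>x. 0 \<le> u x) \<and> (\<forall>K. compact K \<longrightarrow> set_integrable lebesgue K u)"

definition nontrivial_weight :: "(real \<Rightarrow> real) \<Rightarrow> bool" where
  "nontrivial_weight u \<longleftrightarrow> is_weight u \<and> \<not> (AE x in lebesgue. u x = 0)"

text \<open>Real powers of extended nonnegative reals. Only positive exponents \<open>p\<close> are used,
  for which \<open>\<infinity>\<close> to the power \<open>p\<close> is \<open>\<infinity>\<close>.\<close>

definition ennpowr :: "ennreal \<Rightarrow> real \<Rightarrow> ennreal" where
  "ennpowr a p = (if a = \<infinity> then \<infinity> else ennreal (enn2real a powr p))"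

text \<open>The argument \<open>g\<close> is the absolute value of the function whose norm is taken; it may be infinite,
  as a maximal function can be. As \<open>\<infinity> * 0 = 0\<close> in \<^typ>\<open>ennreal\<close>, the values of \<open>g\<close> where \<open>u = 0\<close>
  do not matter.\<close>

definition Lp_norm :: "real \<Rightarrow> (real \<Rightarrow> real) \<Rightarrow> (real \<Rightarrow> ennreal) \<Rightarrow> ennreal" where
  "Lp_norm p u g = ennpowr (\<integral>\<^sup>+x. ennpowr (g x) p * ennreal (u x) \<partial>lebesgue) (1 / p)"

definition Lp_space :: "real \<Rightarrow> (real \<Rightarrow> real) \<Rightarrow> (real \<Rightarrow> real) set" where
  "Lp_space p u = {f \<in> borel_measurable lebesgue.
     (AE x in lebesgue. u x = 0 \<longrightarrow> f x = 0) \<and>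
     (\<integral>\<^sup>+x. ennreal (\<bar>f x\<bar> powr p * u x) \<partial>lebesgue) < \<infinity>}"

text \<open>Functions in a weighted space need not be locally integrable a priori, so the averages and
  their supremum are taken in \<^typ>\<open>ennreal\<close>.\<close>

definition maximal_function :: "(real \<Rightarrow> real) \<Rightarrow> real \<Rightarrow> ennreal" where
  "maximal_function f x =
     (SUP Q \<in> {Q. is_interval Q \<and> bounded Q \<and> 0 < emeasure lebesgue Q}.
        indicator Q x / emeasure lebesgue Q * (\<integral>\<^sup>+y\<in>Q. ennreal \<bar>f y\<bar> \<partial>lebesgue))"

text \<open>\<open>has_hilbert_transform f x h\<close>: the principal value integral of \<open>f y / (y - x)\<close> exists and
  equals \<open>h\<close>. The truncated integrals have to converge absolutely.\<close>

definition has_hilbert_transform :: "(real \<Rightarrow> real) \<Rightarrow> real \<Rightarrow> real \<Rightarrow> bool" where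
  "has_hilbert_transform f x h \<longleftrightarrow>
     (\<forall>\<epsilon>>0. set_integrable lebesgue {y. \<epsilon> < \<bar>y - x\<bar>} (\<lambda>y. f y / (y - x))) \<and>
     ((\<lambda>\<epsilon>. LINT y:{y. \<epsilon> < \<bar>y - x\<bar>}|lebesgue. f y / (y - x)) \<longlongrightarrow> h) (at_right 0)"

definition hilbert_transform :: "(real \<Rightarrow> real) \<Rightarrow> real \<Rightarrow> real" where
  "hilbert_transform f x = (THE h. has_hilbert_transform f x h)"

definition maximal_bounded :: "real \<Rightarrow> (real \<Rightarrow> real) \<Rightarrow> bool" where
  "maximal_bounded p u \<longleftrightarrow> (\<exists>C::real. 0 \<le> C \<and> (\<forall>f\<in>Lp_space p u.
     Lp_norm p u (maximal_function f) \<le> ennreal C * Lp_norm p u (\<lambda>x. ennreal \<bar>f x\<bar>)))"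

text \<open>The inequality is asked only of those \<open>f\<close> for which \<open>Hf\<close> is defined a.e. where \<open>u > 0\<close>.
  Hence unboundedness can be witnessed neither by a function without a Hilbert transform nor by the
  value of an undefined \<open>THE\<close>.\<close>

definition hilbert_bounded :: "real \<Rightarrow> (real \<Rightarrow> real) \<Rightarrow> bool" where
  "hilbert_bounded p u \<longleftrightarrow> (\<exists>C::real. 0 \<le> C \<and> (\<forall>f\<in>Lp_space p u.
     (AE x in lebesgue. 0 < u x \<longrightarrow> (\<exists>h. has_hilbert_transform f x h)) \<longrightarrow>
     Lp_norm p u (\<lambda>x. ennreal \<bar>hilbert_transform f x\<bar>)
       \<le> ennreal C * Lp_norm p u (\<lambda>x. ennreal \<bar>f x\<bar>)))"

end

theory Submission
  imports Defs
begin

text \<open>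
  Let \<open>u x = x powr (- p)\<close> on the union \<open>E\<close> of the blocks \<open>{2 ^ k..2 ^ k + 1}\<close>, and \<open>u = 0\<close> elsewhere.
  For \<open>f\<close> supported on \<open>E\<close> put \<open>g y = \<bar>f y\<bar> / y\<close>, so that the weighted norm of \<open>f\<close> is the
  plain \<open>L\<^sup>p\<close> norm of \<open>g\<close> on \<open>E\<close>. The two operators differ in how the values of \<open>f\<close> on
  far-away blocks act on a given point: one takes a supremum over scales, the other a sum.

  The maximal function averages \<open>f\<close> over intervals. An average reaching out to \<open>d\<close> is at most about
  \<open>1 / d\<close> times the integral of \<open>y * g y\<close> over \<open>E\<close> up to \<open>d\<close>. As the blocks have length 1 and sit at
  powers of 2, the last block dominates this integral, and the average is bounded by a constant times
  the norm. The supremum over \<open>d\<close> obeys the same bound, and a constant is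
  in \<open>L\<^sup>p(u)\<close> because \<open>u\<close> has finite mass. Short intervals see \<open>y\<close> comparable to \<open>x\<close> only,
  and there the claim is the unweighted Hardy-Littlewood theorem for \<open>g\<close>. This is
  \<open>maximal_function_thin_le\<close>; the unweighted theorem is \<open>maximal_strong_type\<close>, derived from
  Vitali's covering lemma.

  The Hilbert transform adds up the contributions of all blocks: on the first block it is about the
  integral of \<open>f y / y\<close>, which is the \<open>L\<^sup>1\<close> norm of \<open>g\<close> if \<open>f \<ge> 0\<close>. Since
  \<open>E\<close> has infinite measure and \<open>p > 1\<close>, that norm is not controlled by the \<open>L\<^sup>p\<close> norm: with \<open>g\<close>
  about 1 on \<open>n\<close> blocks the two are \<open>n\<close> and \<open>n powr (1 / p)\<close>
  (\<open>staircase_hilbert_transform_ge\<close>, \<open>staircase_thin_norm\<close>).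
\<close>

section \<open>Lebesgue measurability and powers of extended reals\<close>

lemma ident_measurable_lebesgue [measurable]: "(\<lambda>x::real. x) \<in> borel_measurable lebesgue"
  by (intro measurable_completion) simp

lemma sigma_finite_lebesgue: "sigma_finite_measure (lebesgue :: real measure)"
proof
  show "\<exists>A. countable A \<and> A \<subseteq> sets (lebesgue :: real measure) \<and> \<Union> A = space lebesgue
          \<and> (\<forall>a\<in>A. emeasure lebesgue a \<noteq> \<infinity>)"
    using emeasure_lborel_cball_finite[of "0::real"]
    by (intro exI[of _ "range (\<lambda>n::nat. cball (0::real) n)"])
       (auto simp: real_arch_simple less_top[symmetric])
qed

lemma nn_integral_powr_below:
  assumes q: "0 < q" and a: "0 \<le> (a::real)"
  shows "(\<integral>\<^sup>+t. (if 0 < t \<and> t < a then ennreal (q * t powr (q - 1)) else 0) \<partial>lborel) = ennreal (a powr q)"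
proof -
  let ?f = "\<lambda>t. if t \<in> {0..a} then q * t powr (q - 1) else 0"
  have "((\<lambda>t. q * t powr (q - 1)) has_integral q * (a powr (q - 1 + 1) / (q - 1 + 1))) {0..a}"
    using q a by (intro has_integral_mult_right has_integral_powr_from_0) auto
  hence "(?f has_integral a powr q) UNIV"
    using q by (subst has_integral_restrict_UNIV) simp
  hence "integral\<^sup>N lborel ?f = a powr q"
    using q by (intro nn_integral_has_integral_lborel) auto
  moreover have "(\<integral>\<^sup>+t. (if 0 < t \<and> t < a then ennreal (q * t powr (q - 1)) else 0) \<partial>lborel) = integral\<^sup>N lborel ?f"
    using AE_lborel_singleton[of a] by (intro nn_integral_cong_AE) (auto elim!: eventually_mono)
  ultimately show ?thesis by simp
qed

text \<open>Writing the power as an integral over the heights \<open>t\<close> below \<open>z\<close> reduces integrals of powers of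
  the maximal function to the measures of its superlevel sets.\<close>

lemma ennpowr_layer_cake:
  assumes q: "0 < q"
  shows "ennpowr z q = (\<integral>\<^sup>+t. (if 0 < t \<and> ennreal t < z then ennreal (q * t powr (q - 1)) else 0) \<partial>lborel)"
    (is "_ = ?R z")
proof (cases z)
  case (real a)
  have "?R z = (\<integral>\<^sup>+t. (if 0 < t \<and> t < a then ennreal (q * t powr (q - 1)) else 0) \<partial>lborel)"
    using real by (intro nn_integral_cong) (auto simp: ennreal_less_iff)
  thus ?thesis using nn_integral_powr_below[OF q] real by (simp add: ennpowr_def)
next
  case top
  have *: "ennreal (a powr q) \<le> ?R z" if "0 \<le> a" for a
    unfolding nn_integral_powr_below[OF q that, symmetric] top
    by (intro nn_integral_mono) auto
  have "?R z = \<infinity>"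
  proof (rule ccontr)
    assume "?R z \<noteq> \<infinity>"
    then obtain r where r: "?R z = ennreal r" "0 \<le> r" by (cases "?R z") auto
    show False using *[of "(r + 1) powr (1 / q)"] r q by (simp add: powr_powr)
  qed
  thus ?thesis using top by (simp add: ennpowr_def)
qed

lemma ennpowr_measurable [measurable]:
  assumes "0 < q"
  shows "(\<lambda>z. ennpowr z q) \<in> borel_measurable borel"
  unfolding ennpowr_layer_cake[OF assms] by measurable

lemma ennpowr_mono: "0 \<le> q \<Longrightarrow> a \<le> b \<Longrightarrow> ennpowr a q \<le> ennpowr b q"
  by (cases a; cases b) (auto simp: ennpowr_def top_unique intro!: ennreal_leI powr_mono2)

lemma ennpowr_ennreal: "0 \<le> a \<Longrightarrow> ennpowr (ennreal a) q = ennreal (a powr q)"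
  by (simp add: ennpowr_def)

lemma ennpowr_mult: "0 \<le> a \<Longrightarrow> 0 < q \<Longrightarrow> a \<noteq> 0 \<Longrightarrow> ennpowr (ennreal a * z) q = ennreal (a powr q) * ennpowr z q"
  by (cases z) (auto simp: ennpowr_def ennreal_mult[symmetric] ennreal_mult_top ennreal_mult_eq_top_iff powr_mult)

lemma ennpowr_add_le:
  assumes q: "0 < q"
  shows "ennpowr (a + b) q \<le> ennreal (2 powr q) * (ennpowr a q + ennpowr b q)"
proof -
  have "ennpowr (a + b) q \<le> ennpowr (ennreal 2 * max a b) q"
    using q by (intro ennpowr_mono) (auto simp: mult_2 max_def intro: add_mono)
  also have "\<dots> = ennreal (2 powr q) * ennpowr (max a b) q"
    using q by (subst ennpowr_mult) auto
  also have "\<dots> \<le> ennreal (2 powr q) * (ennpowr a q + ennpowr b q)"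
    by (intro mult_left_mono) (auto simp: max_def)
  finally show ?thesis .
qed

section \<open>The unweighted maximal theorem on the line\<close>

lemma bounded_interval_hull:
  fixes Q :: "real set"
  assumes "is_interval Q" "bounded Q" "0 < emeasure lebesgue Q"
  obtains a b where "a < b" "Q \<subseteq> {a..b}" "emeasure lebesgue Q = ennreal (b - a)"
proof -
  define a b where "a = Inf Q" and "b = Sup Q"
  have ne: "Q \<noteq> {}" using assms(3) by auto
  have bd: "bdd_above Q" "bdd_below Q"
    using assms(2) by (auto intro: bounded_imp_bdd_above bounded_imp_bdd_below)
  have sub: "Q \<subseteq> {a..b}"
    using bd by (auto simp: a_def b_def intro: cInf_lower cSup_upper)
  have sup: "{a<..<b} \<subseteq> Q"
  proof
    fix y assume "y \<in> {a<..<b}"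
    then obtain s t where "s \<in> Q" "s < y" "t \<in> Q" "y < t"
      using bd ne by (auto simp: a_def b_def cInf_less_iff less_cSup_iff)
    then show "y \<in> Q" using assms(1) unfolding is_interval_1 by (meson less_imp_le)
  qed
  have ab: "a \<le> b" using ne sub by fastforce
  have Q: "Q \<in> sets lebesgue"
    using assms(3) by (metis emeasure_notin_sets less_irrefl)
  have "emeasure lebesgue Q \<le> emeasure lebesgue {a..b}" using sub by (intro emeasure_mono) auto
  moreover have "emeasure lebesgue {a<..<b} \<le> emeasure lebesgue Q"
    using sup Q by (intro emeasure_mono) auto
  ultimately have m: "emeasure lebesgue Q = ennreal (b - a)" using ab by simp
  moreover have "a < b" using m assms(3) by simp
  ultimately show ?thesis using that sub by blast
qed

text \<open>The maximal function is a supremum over intervals of any kind. The next three facts replace it by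
  conditions on compact intervals, and nothing else is used about it later. The first two are nearly
  converse to each other: an average over a compact interval is a lower bound at each of its points,
  and a strict lower bound always comes from a compact interval with the point in its interior.\<close>

lemma maximal_function_ge:
  assumes "c < d" "c \<le> x" "x \<le> d"
  shows "(\<integral>\<^sup>+y\<in>{c..d}. ennreal \<bar>f y\<bar> \<partial>lebesgue) \<le> maximal_function f x * ennreal (d - c)"
proof -
  let ?I = "\<integral>\<^sup>+y\<in>{c..d}. ennreal \<bar>f y\<bar> \<partial>lebesgue"
  have "indicator {c..d} x / emeasure lebesgue {c..d} * ?I \<le> maximal_function f x"
    unfolding maximal_function_def
    by (rule SUP_upper) (use assms in \<open>auto simp: is_interval_cc\<close>)
  hence "inverse (ennreal (d - c)) * ?I \<le> maximal_function f x"
    using assms by (simp add: divide_ennreal_def)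
  hence "inverse (ennreal (d - c)) * ?I * ennreal (d - c) \<le> maximal_function f x * ennreal (d - c)"
    by (rule mult_right_mono) simp
  moreover have "inverse (ennreal (d - c)) * ennreal (d - c) = 1"
    using assms by (simp add: inverse_ennreal ennreal_mult[symmetric])
  ultimately show ?thesis
    by (metis (no_types, lifting) mult.assoc mult.commute mult_1)
qed

text \<open>The inequality is strict, so the interval can be enlarged a little on both sides without
  spoiling it. That the point becomes interior is what makes the superlevel sets open.\<close>

lemma maximal_function_gtE:
  assumes "t < maximal_function f x"
  obtains c d where "c < x" "x < d"
    "t * ennreal (d - c) < (\<integral>\<^sup>+y\<in>{c..d}. ennreal \<bar>f y\<bar> \<partial>lebesgue)"
proof -
  let ?I = "\<lambda>Q. \<integral>\<^sup>+y\<in>Q. ennreal \<bar>f y\<bar> \<partial>lebesgue"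
  obtain Q where Q: "is_interval Q" "bounded Q" "0 < emeasure lebesgue Q"
    and tQ: "t < indicator Q x / emeasure lebesgue Q * ?I Q"
    using assms by (auto simp: maximal_function_def less_SUP_iff)
  have x: "x \<in> Q" using tQ by (cases "x \<in> Q") auto
  obtain a b where ab: "a < b" "Q \<subseteq> {a..b}" "emeasure lebesgue Q = ennreal (b - a)"
    using bounded_interval_hull[OF Q] .
  obtain t' where t': "t = ennreal t'" "0 \<le> t'" using assms by (cases t) auto
  have "t < inverse (ennreal (b - a)) * ?I Q" using tQ x ab by (simp add: divide_ennreal_def)
  hence "t * ennreal (b - a) < inverse (ennreal (b - a)) * ?I Q * ennreal (b - a)"
    using ab by (intro ennreal_mult_strict_right_mono) auto
  also have "\<dots> = (inverse (ennreal (b - a)) * ennreal (b - a)) * ?I Q"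
    by (simp add: mult_ac)
  also have "\<dots> = ?I Q"
    using ab by (simp add: inverse_ennreal ennreal_mult[symmetric])
  finally have "ennreal (t' * (b - a)) < ?I Q" using t' ab by (simp add: ennreal_mult)
  then obtain s' where s': "ennreal (t' * (b - a)) < s'" "s' < ?I Q" using dense by blast
  then obtain s where s: "s' = ennreal s" "0 \<le> s" by (cases s') auto
  have ts: "t' * (b - a) < s" using s s' t' ab by (simp add: ennreal_less_iff)
  \<comment> \<open>Small enough that lengthening the interval by \<open>2 * e\<close> costs at most the gap \<open>s - t' * (b - a)\<close>.\<close>
  define e where "e = (s - t' * (b - a)) / (2 * (t' + 1))"
  have e: "0 < e" using ts t' by (simp add: e_def)
  have "2 * e * t' \<le> 2 * e * (t' + 1)" using e by simp
  also have "\<dots> = s - t' * (b - a)" using t' by (simp add: e_def divide_simps) (simp add: algebra_simps)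
  finally have "t' * ((b + e) - (a - e)) \<le> s" by (simp add: algebra_simps)
  hence "t * ennreal ((b + e) - (a - e)) \<le> s'"
    unfolding t' s using t' ab e by (subst ennreal_mult[symmetric]) (auto intro!: ennreal_leI)
  also have "s' < ?I Q" by fact
  also have "\<dots> \<le> ?I {a - e..b + e}"
    using ab e by (intro nn_integral_mono) (auto simp: indicator_def)
  finally show ?thesis using that[of "a - e" "b + e"] x ab e by auto
qed

lemma maximal_function_le:
  assumes "\<And>c d. c < x \<Longrightarrow> x < d \<Longrightarrow>
    (\<integral>\<^sup>+y\<in>{c..d}. ennreal \<bar>f y\<bar> \<partial>lebesgue) \<le> K * ennreal (d - c)"
  shows "maximal_function f x \<le> K"
proof (rule ccontr)
  assume "\<not> ?thesis"
  then obtain c d where "c < x" "x < d"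
    "K * ennreal (d - c) < (\<integral>\<^sup>+y\<in>{c..d}. ennreal \<bar>f y\<bar> \<partial>lebesgue)"
    using maximal_function_gtE by (metis not_le)
  thus False using assms by fastforce
qed

lemma maximal_function_measurable [measurable]:
  "maximal_function f \<in> borel_measurable borel"
proof (rule borel_measurableI_greater)
  fix t :: ennreal
  have "open {x. t < maximal_function f x}"
  proof (subst open_subopen, intro ballI)
    fix x assume "x \<in> {x. t < maximal_function f x}"
    then obtain c d where cd: "c < x" "x < d"
      "t * ennreal (d - c) < (\<integral>\<^sup>+y\<in>{c..d}. ennreal \<bar>f y\<bar> \<partial>lebesgue)"
      by (auto elim: maximal_function_gtE)
    have "{c<..<d} \<subseteq> {x. t < maximal_function f x}"
    proof
      fix z assume z: "z \<in> {c<..<d}"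
      have "t * ennreal (d - c) < maximal_function f z * ennreal (d - c)"
        using cd(3) maximal_function_ge[of c d z f] z by (auto intro: less_le_trans)
      thus "z \<in> {x. t < maximal_function f x}"
        using mult_right_mono[of "maximal_function f z" t "ennreal (d - c)"]
        by (auto simp: not_le[symmetric])
    qed
    moreover have "x \<in> {c<..<d}" using cd by simp
    ultimately show "\<exists>T. open T \<and> x \<in> T \<and> T \<subseteq> {x. t < maximal_function f x}"
      using open_greaterThanLessThan by blast
  qed
  thus "{x \<in> space borel. t < maximal_function f x} \<in> sets borel" by simp
qed

text \<open>The weak-type inequality in the form needed for \<open>p > 1\<close>: only the part of \<open>g\<close> above height
  \<open>t / 2\<close> is charged. On an interval where the mean of \<open>\<bar>g\<bar>\<close> exceeds \<open>t\<close>, the part of \<open>g\<close> below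
  that height contributes at most \<open>t / 2\<close> to the mean, so the rest has mean at least \<open>t / 2\<close>.
  In particular the lengths of such intervals are bounded, and Vitali's covering lemma selects
  disjoint ones whose fivefold dilates cover the superlevel set.\<close>

lemma maximal_weak_type:
  fixes g :: "real \<Rightarrow> real"
  assumes [measurable]: "g \<in> borel_measurable lebesgue" and t: "0 < t"
  shows "emeasure lebesgue {x. ennreal t < maximal_function g x}
    \<le> ennreal (10 / t) * (\<integral>\<^sup>+y. ennreal \<bar>g y\<bar> * indicator {y. t / 2 < \<bar>g y\<bar>} y \<partial>lebesgue)"
proof -
  define h :: "real \<Rightarrow> ennreal" where "h = (\<lambda>y. ennreal \<bar>g y\<bar> * indicator {y. t / 2 < \<bar>g y\<bar>} y)"
  have [measurable]: "h \<in> borel_measurable lebesgue" unfolding h_def by measurable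
  have [measurable]: "cball (a :: real) r \<in> sets lebesgue" for a r by auto
  show ?thesis
  proof (cases "(\<integral>\<^sup>+y. h y \<partial>lebesgue) = \<infinity>")
    case True
    thus ?thesis using t unfolding h_def by (simp add: ennreal_mult_top)
  next
    case False
    then obtain B where B: "(\<integral>\<^sup>+y. h y \<partial>lebesgue) = ennreal B" "0 \<le> B"
      by (cases "\<integral>\<^sup>+y. h y \<partial>lebesgue") auto
    define K :: "(real \<times> real) set" where
      "K = {(a, r). 0 < r \<and> ennreal (t * (2 * r)) < (\<integral>\<^sup>+y\<in>cball a r. ennreal \<bar>g y\<bar> \<partial>lebesgue)}"
    have heavy: "ennreal (t * r) \<le> (\<integral>\<^sup>+y\<in>cball a r. h y \<partial>lebesgue)" if "(a, r) \<in> K" for a r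
    proof -
      have r: "0 < r" using that by (simp add: K_def)
      have em: "emeasure lebesgue (cball a r) = ennreal (2 * r)"
        using r by (simp add: cball_eq_atLeastAtMost)
      have "ennreal (t * r) + ennreal (t * r) = ennreal (t * (2 * r))"
        using t r by (simp add: ennreal_plus[symmetric] del: ennreal_plus)
      also have "\<dots> \<le> (\<integral>\<^sup>+y\<in>cball a r. ennreal \<bar>g y\<bar> \<partial>lebesgue)"
        using that by (simp add: K_def less_imp_le)
      also have "\<dots> \<le> (\<integral>\<^sup>+y. h y * indicator (cball a r) y
                        + ennreal (t / 2) * indicator (cball a r) y \<partial>lebesgue)"
        by (intro nn_integral_mono) (auto simp: h_def indicator_def intro!: ennreal_leI)
      also have "\<dots> = (\<integral>\<^sup>+y\<in>cball a r. h y \<partial>lebesgue) + ennreal (t / 2) * ennreal (2 * r)"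
        by (subst nn_integral_add) (auto simp: nn_integral_cmult em)
      also have "ennreal (t / 2) * ennreal (2 * r) = ennreal (t * r)"
        using t r by (simp add: ennreal_mult[symmetric])
      finally show ?thesis by (simp add: add.commute ennreal_add_left_cancel_le)
    qed
    have rB: "r \<le> B / t" if "(a, r) \<in> K" for a r
    proof -
      have "ennreal (t * r) \<le> (\<integral>\<^sup>+y\<in>cball a r. h y \<partial>lebesgue)" by (rule heavy[OF that])
      also have "\<dots> \<le> (\<integral>\<^sup>+y. h y \<partial>lebesgue)" by (intro nn_integral_mono) (auto simp: indicator_def)
      finally have "t * r \<le> B" using B by simp
      thus ?thesis using t by (simp add: field_simps)
    qed
    have cov: "{x. ennreal t < maximal_function g x} \<subseteq> (\<Union>i\<in>K. cball (fst i) (snd i))"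
    proof
      fix x assume "x \<in> {x. ennreal t < maximal_function g x}"
      then obtain c d where cd: "c < x" "x < d"
        "ennreal t * ennreal (d - c) < (\<integral>\<^sup>+y\<in>{c..d}. ennreal \<bar>g y\<bar> \<partial>lebesgue)"
        by (auto elim: maximal_function_gtE)
      let ?a = "(c + d) / 2" and ?r = "(d - c) / 2"
      have eq: "cball ?a ?r = {c..d}"
        unfolding cball_eq_atLeastAtMost by (rule arg_cong2[of _ _ _ _ atLeastAtMost]) (simp_all add: field_simps)
      have "ennreal (t * (2 * ?r)) = ennreal t * ennreal (d - c)"
        using cd t by (subst ennreal_mult[symmetric]) auto
      hence "(?a, ?r) \<in> K" unfolding K_def using cd by (simp only: eq mem_Collect_eq prod.case) simp
      moreover have "x \<in> cball (fst (?a, ?r)) (snd (?a, ?r))" using eq cd by simp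
      ultimately show "x \<in> (\<Union>i\<in>K. cball (fst i) (snd i))" by blast
    qed
    obtain C where C: "countable C" "C \<subseteq> K"
      "pairwise (\<lambda>i j. disjnt (cball (fst i) (snd i)) (cball (fst j) (snd j))) C"
      "{x. ennreal t < maximal_function g x} \<subseteq> (\<Union>i\<in>C. cball (fst i) (5 * snd i))"
    proof (rule Vitali_covering_lemma_cballs[OF cov])
      show "0 < snd i \<and> snd i \<le> B / t" if "i \<in> K" for i
        using that rB[of "fst i" "snd i"] by (auto simp: K_def)
    qed
    \<comment> \<open>Viewing \<open>h\<close> as a density turns disjointness of the selected intervals into additivity of a measure.\<close>
    have "(\<integral>\<^sup>+i. emeasure (density lebesgue h) (cball (fst i) (snd i)) \<partial>count_space C)
        = emeasure (density lebesgue h) (\<Union>i\<in>C. cball (fst i) (snd i))"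
      using C by (intro emeasure_UN_countable[symmetric])
                 (auto simp: disjoint_family_on_def pairwise_def disjnt_def)
    also have "\<dots> \<le> emeasure (density lebesgue h) (space (density lebesgue h))"
      by (rule emeasure_space)
    also have "\<dots> = (\<integral>\<^sup>+y. h y \<partial>lebesgue)"
      by (simp add: emeasure_density)
    finally have total: "(\<integral>\<^sup>+i. emeasure (density lebesgue h) (cball (fst i) (snd i)) \<partial>count_space C)
        \<le> (\<integral>\<^sup>+y. h y \<partial>lebesgue)" .
    have "emeasure lebesgue {x. ennreal t < maximal_function g x}
          \<le> emeasure lebesgue (\<Union>i\<in>C. cball (fst i) (5 * snd i))"
      using C by (intro emeasure_mono sets.countable_UN') auto
    also have "\<dots> = (\<integral>\<^sup>+x. indicator (\<Union>i\<in>C. cball (fst i) (5 * snd i)) x \<partial>lebesgue)"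
      using C by (subst nn_integral_indicator) (auto intro!: sets.countable_UN')
    also have "\<dots> \<le> (\<integral>\<^sup>+x. \<integral>\<^sup>+i. indicator (cball (fst i) (5 * snd i)) x \<partial>count_space C \<partial>lebesgue)"
    proof (rule nn_integral_mono)
      fix x :: real
      show "indicator (\<Union>i\<in>C. cball (fst i) (5 * snd i)) x
          \<le> (\<integral>\<^sup>+i. indicator (cball (fst i) (5 * snd i)) x \<partial>count_space C :: ennreal)"
      proof (cases "x \<in> (\<Union>i\<in>C. cball (fst i) (5 * snd i))")
        case True
        then obtain i where "i \<in> C" "x \<in> cball (fst i) (5 * snd i)" by blast
        with nn_integral_ge_point[of i C "\<lambda>i. indicator (cball (fst i) (5 * snd i)) x"] True
        show ?thesis by simp
      qed simp
    qed
    also have "\<dots> = (\<integral>\<^sup>+i. \<integral>\<^sup>+x. indicator (cball (fst i) (5 * snd i)) x \<partial>lebesgue \<partial>count_space C)"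
      using C by (intro nn_integral_count_space_nn_integral) auto
    also have "\<dots> \<le> (\<integral>\<^sup>+i. ennreal (10 / t) * emeasure (density lebesgue h) (cball (fst i) (snd i)) \<partial>count_space C)"
    proof (rule nn_integral_mono)
      fix i assume "i \<in> space (count_space C)"
      then obtain a r where i: "i = (a, r)" "(a, r) \<in> K" using C by (cases i) auto
      have r: "0 < r" using i by (simp add: K_def)
      have "(\<integral>\<^sup>+x. indicator (cball (fst i) (5 * snd i)) x \<partial>lebesgue) = ennreal (10 * r)"
        using r i by (simp add: cball_eq_atLeastAtMost)
      also have "\<dots> = ennreal (10 / t) * ennreal (t * r)"
        using t r by (simp add: ennreal_mult[symmetric])
      also have "\<dots> \<le> ennreal (10 / t) * (\<integral>\<^sup>+y\<in>cball a r. h y \<partial>lebesgue)"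
        by (intro mult_left_mono heavy i) simp
      also have "\<dots> = ennreal (10 / t) * emeasure (density lebesgue h) (cball (fst i) (snd i))"
        using i by (simp add: emeasure_density)
      finally show "(\<integral>\<^sup>+x. indicator (cball (fst i) (5 * snd i)) x \<partial>lebesgue) \<le> \<dots>" .
    qed
    also have "\<dots> = ennreal (10 / t) * (\<integral>\<^sup>+i. emeasure (density lebesgue h) (cball (fst i) (snd i)) \<partial>count_space C)"
      by (rule nn_integral_cmult) simp
    also have "\<dots> \<le> ennreal (10 / t) * (\<integral>\<^sup>+y. h y \<partial>lebesgue)"
      by (intro mult_left_mono total) simp
    finally show ?thesis unfolding h_def .
  qed
qed

text \<open>The Hardy-Littlewood theorem on the line without weight. In the layer-cake integral the weak-type
  bound charges \<open>\<bar>g y\<bar>\<close> only at heights \<open>t < 2 * \<bar>g y\<bar>\<close>; after exchanging the integrals, the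
  remaining power \<open>t powr (p - 2)\<close> is integrable at 0 exactly because \<open>p > 1\<close>.\<close>

theorem maximal_strong_type:
  fixes g :: "real \<Rightarrow> real"
  assumes p: "1 < p" and [measurable]: "g \<in> borel_measurable lebesgue"
  shows "(\<integral>\<^sup>+x. ennpowr (maximal_function g x) p \<partial>lebesgue)
    \<le> ennreal (10 * p / (p - 1) * 2 powr (p - 1)) * (\<integral>\<^sup>+x. ennreal (\<bar>g x\<bar> powr p) \<partial>lebesgue)"
proof -
  interpret L: sigma_finite_measure "lebesgue :: real measure" by (rule sigma_finite_lebesgue)
  interpret P: pair_sigma_finite "lebesgue :: real measure" "lborel :: real measure" ..
  have [measurable]: "maximal_function g \<in> borel_measurable lebesgue" by measurable
  let ?k = "10 * p / (p - 1)"
  let ?G = "\<lambda>t y. if 0 < t \<and> t < 2 * \<bar>g y\<bar> then ennreal ((p - 1) * t powr (p - 1 - 1)) else 0"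
  have k: "0 \<le> ?k" using p by simp
  have "(\<integral>\<^sup>+x. ennpowr (maximal_function g x) p \<partial>lebesgue)
      = (\<integral>\<^sup>+x. \<integral>\<^sup>+t. (if 0 < t \<and> ennreal t < maximal_function g x
           then ennreal (p * t powr (p - 1)) else 0) \<partial>lborel \<partial>lebesgue)"
    using p by (subst ennpowr_layer_cake) auto
  also have "\<dots> = (\<integral>\<^sup>+t. \<integral>\<^sup>+x. (if 0 < t \<and> ennreal t < maximal_function g x
           then ennreal (p * t powr (p - 1)) else 0) \<partial>lebesgue \<partial>lborel)"
    by (rule P.Fubini'[symmetric]) measurable
  also have "\<dots> \<le> (\<integral>\<^sup>+t. \<integral>\<^sup>+y. ennreal ?k * (ennreal \<bar>g y\<bar> * ?G t y) \<partial>lebesgue \<partial>lborel)"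
  proof (rule nn_integral_mono)
    fix t :: real
    show "(\<integral>\<^sup>+x. (if 0 < t \<and> ennreal t < maximal_function g x
           then ennreal (p * t powr (p - 1)) else 0) \<partial>lebesgue)
         \<le> (\<integral>\<^sup>+y. ennreal ?k * (ennreal \<bar>g y\<bar> * ?G t y) \<partial>lebesgue)"
    proof (cases "0 < t")
      case t: True
      have "{x \<in> space lebesgue. ennreal t < maximal_function g x} \<in> sets lebesgue" by measurable
      hence level: "{x. ennreal t < maximal_function g x} \<in> sets lebesgue" by simp
      have "(\<integral>\<^sup>+x. (if 0 < t \<and> ennreal t < maximal_function g x
           then ennreal (p * t powr (p - 1)) else 0) \<partial>lebesgue)
          = (\<integral>\<^sup>+x. ennreal (p * t powr (p - 1)) * indicator {x. ennreal t < maximal_function g x} x \<partial>lebesgue)"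
        using t by (intro nn_integral_cong) auto
      also have "\<dots> = ennreal (p * t powr (p - 1)) * emeasure lebesgue {x. ennreal t < maximal_function g x}"
        by (rule nn_integral_cmult_indicator[OF level])
      also have "\<dots> \<le> ennreal (p * t powr (p - 1)) * (ennreal (10 / t) *
          (\<integral>\<^sup>+y. ennreal \<bar>g y\<bar> * indicator {y. t / 2 < \<bar>g y\<bar>} y \<partial>lebesgue))"
        using t by (intro mult_left_mono maximal_weak_type) auto
      also have "\<dots> = (\<integral>\<^sup>+y. ennreal (p * t powr (p - 1) * (10 / t)) *
          (ennreal \<bar>g y\<bar> * indicator {y. t / 2 < \<bar>g y\<bar>} y) \<partial>lebesgue)"
      proof -
        have "ennreal (p * t powr (p - 1) * (10 / t)) = ennreal (p * t powr (p - 1)) * ennreal (10 / t)"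
          using t p by (intro ennreal_mult) auto
        thus ?thesis by (subst nn_integral_cmult) (measurable, simp only: mult.assoc)
      qed
      also have "p * t powr (p - 1) * (10 / t) = ?k * ((p - 1) * t powr (p - 1 - 1))"
      proof -
        have B: "t powr (p - 1 - 1) = t powr (p - 1) / t" using t by (simp only: powr_diff[of t "p - 1" 1]) simp
        have k10: "?k * ((p - 1) * x) = 10 * p * x" for x using p by simp
        show ?thesis unfolding B k10 by simp
      qed
      also have "(\<integral>\<^sup>+y. ennreal (?k * ((p - 1) * t powr (p - 1 - 1))) *
            (ennreal \<bar>g y\<bar> * indicator {y. t / 2 < \<bar>g y\<bar>} y) \<partial>lebesgue)
          = (\<integral>\<^sup>+y. ennreal ?k * (ennreal \<bar>g y\<bar> * ?G t y) \<partial>lebesgue)"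
        unfolding ennreal_mult'[OF k]
        using t by (intro nn_integral_cong) (auto simp: indicator_def mult_ac)
      finally show ?thesis .
    qed simp
  qed
  also have "\<dots> = (\<integral>\<^sup>+y. \<integral>\<^sup>+t. ennreal ?k * (ennreal \<bar>g y\<bar> * ?G t y) \<partial>lborel \<partial>lebesgue)"
    by (rule P.Fubini') measurable
  also have "\<dots> = (\<integral>\<^sup>+y. ennreal (?k * 2 powr (p - 1)) * ennreal (\<bar>g y\<bar> powr p) \<partial>lebesgue)"
  proof (rule nn_integral_cong)
    fix y :: real
    have "(\<integral>\<^sup>+t. ennreal ?k * (ennreal \<bar>g y\<bar> * ?G t y) \<partial>lborel)
        = ennreal ?k * (ennreal \<bar>g y\<bar> * ennreal ((2 * \<bar>g y\<bar>) powr (p - 1)))"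
      using p by (simp add: nn_integral_cmult nn_integral_powr_below del: ennreal_numeral)
    also have "\<dots> = ennreal (?k * (\<bar>g y\<bar> * (2 * \<bar>g y\<bar>) powr (p - 1)))"
      by (simp only: ennreal_mult k abs_ge_zero powr_ge_zero mult_nonneg_nonneg)
    also have "?k * (\<bar>g y\<bar> * (2 * \<bar>g y\<bar>) powr (p - 1)) = ?k * 2 powr (p - 1) * \<bar>g y\<bar> powr p"
      using p by (cases "g y = 0") (simp_all add: powr_mult powr_diff)
    finally show "(\<integral>\<^sup>+t. ennreal ?k * (ennreal \<bar>g y\<bar> * ?G t y) \<partial>lborel)
        = ennreal (?k * 2 powr (p - 1)) * ennreal (\<bar>g y\<bar> powr p)"
      by (simp only: ennreal_mult k powr_ge_zero mult_nonneg_nonneg)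
  qed
  also have "\<dots> = ennreal (?k * 2 powr (p - 1)) * (\<integral>\<^sup>+y. ennreal (\<bar>g y\<bar> powr p) \<partial>lebesgue)"
    by (rule nn_integral_cmult) measurable
  finally show ?thesis .
qed

section \<open>A weight on a thin set\<close>

definition thin_set :: "real set" where
  "thin_set = (\<Union>k. {2 ^ k..2 ^ k + 1})"

definition thin_weight :: "real \<Rightarrow> real \<Rightarrow> real" where
  "thin_weight p x = (if x \<in> thin_set then x powr (- p) else 0)"

lemma thin_set_borel [measurable]: "thin_set \<in> sets borel"
  unfolding thin_set_def by measurable

lemma thin_set_lebesgue [measurable]: "thin_set \<in> sets lebesgue"
  by (intro sets_completionI_sets) simp

lemma thin_set_ge_1: "x \<in> thin_set \<Longrightarrow> 1 \<le> x"
  using order_trans[OF two_realpow_ge_one] by (auto simp: thin_set_def)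

lemma first_block_subset_thin_set: "{1..2} \<subseteq> thin_set"
proof -
  have "{2 ^ 0..2 ^ 0 + 1} \<subseteq> thin_set" unfolding thin_set_def by blast
  thus ?thesis by simp
qed

lemma thin_weight_measurable [measurable]: "thin_weight p \<in> borel_measurable borel"
  unfolding thin_weight_def by measurable

lemma thin_weight_nonneg: "0 \<le> thin_weight p x"
  by (simp add: thin_weight_def)

lemma thin_weight_mass:
  assumes p: "1 < p"
  shows "(\<integral>\<^sup>+x. ennreal (thin_weight p x) \<partial>lebesgue) \<le> ennreal (1 / (p - 1))"
proof -
  let ?f = "\<lambda>x::real. if x \<in> {1..} then x powr (- p) else 0"
  have "((\<lambda>x::real. x powr (- p)) has_integral - (1 powr (- p + 1)) / (- p + 1)) {1..}"
    using p by (intro has_integral_powr_to_inf) auto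
  hence "(?f has_integral 1 / (p - 1)) UNIV"
    using p by (subst has_integral_restrict_UNIV) (simp add: minus_divide_right)
  hence "integral\<^sup>N lborel ?f = 1 / (p - 1)"
    by (intro nn_integral_has_integral_lborel) auto
  moreover have "(\<integral>\<^sup>+x. ennreal (thin_weight p x) \<partial>lebesgue) \<le> integral\<^sup>N lborel ?f"
    unfolding nn_integral_completion
    by (intro nn_integral_mono) (auto simp: thin_weight_def dest: thin_set_ge_1)
  ultimately show ?thesis by simp
qed

lemma nontrivial_thin_weight:
  assumes p: "1 < p"
  shows "nontrivial_weight (thin_weight p)"
proof -
  have le: "thin_weight p x \<le> 1" for x
    using thin_set_ge_1[of x] p powr_mono2'[of "- p" 1 x] by (auto simp: thin_weight_def)
  have [measurable]: "thin_weight p \<in> borel_measurable lebesgue"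
    by (intro measurable_completion) simp
  have "set_integrable lebesgue K (thin_weight p)" if K: "compact K" for K
    unfolding set_integrable_def
  proof (rule Bochner_Integration.integrable_bound)
    have Kl: "K \<in> sets lebesgue" using compact_imp_closed[OF K] by auto
    show "integrable lebesgue (indicator K :: real \<Rightarrow> real)"
      using emeasure_compact_finite[OF K] Kl compact_imp_closed[OF K] by (simp add: less_top)
    show "(\<lambda>x. indicat_real K x *\<^sub>R thin_weight p x) \<in> borel_measurable lebesgue"
      using Kl by measurable
  qed (use le thin_weight_nonneg in \<open>auto simp: indicator_def\<close>)
  moreover have "\<not> (AE x in lebesgue. thin_weight p x = 0)"
  proof
    assume "AE x in lebesgue. thin_weight p x = 0"
    moreover have "thin_weight p x \<noteq> 0" if "x \<in> {1..2}" for x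
      using that first_block_subset_thin_set by (auto simp: thin_weight_def)
    ultimately have "AE x in lebesgue. x \<notin> {1..2::real}" by (auto elim!: eventually_mono)
    hence "emeasure lebesgue {1..2::real} = 0"
      by (subst (asm) AE_iff_null_sets[symmetric]) auto
    thus False by simp
  qed
  ultimately show ?thesis
    unfolding nontrivial_weight_def is_weight_def using thin_weight_nonneg by blast
qed

text \<open>This is where thinness enters: the blocks have length 1 and lie at geometrically growing places,
  so the first moment up to \<open>b\<close> is dominated by the last block. (For a half-line it would be of
  order \<open>b\<^sup>2\<close>.)\<close>

lemma thin_set_first_moment:
  assumes b: "0 \<le> b"
  shows "(\<integral>\<^sup>+y. ennreal y * indicator (thin_set \<inter> {..b}) y \<partial>lebesgue) \<le> ennreal (4 * b)"
proof (cases "1 \<le> b")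
  case False
  hence "(\<integral>\<^sup>+y. ennreal y * indicator (thin_set \<inter> {..b}) y \<partial>lebesgue) = (\<integral>\<^sup>+y. 0 \<partial>(lebesgue :: real measure))"
    using thin_set_ge_1 by (intro nn_integral_cong) (force simp: indicator_def)
  thus ?thesis by simp
next
  case True
  obtain n where n: "2 ^ n \<le> b" "b < 2 ^ Suc n"
  proof -
    obtain N where "b < 2 ^ N" using real_arch_pow[of 2 b] by auto
    moreover have "\<not> b < 2 ^ 0" using True by simp
    ultimately obtain n where "\<forall>i\<le>n. \<not> b < 2 ^ i" "b < 2 ^ Suc n"
      using ex_least_nat_less[of "\<lambda>n. b < 2 ^ n" N] by blast
    thus ?thesis using that[of n] by (simp add: not_less)
  qed
  have "(\<integral>\<^sup>+y. ennreal y * indicator (thin_set \<inter> {..b}) y \<partial>lebesgue)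
      \<le> (\<integral>\<^sup>+y. (\<Sum>k\<le>n. ennreal (2 ^ k + 1) * indicator {2 ^ k..2 ^ k + 1 :: real} y) \<partial>lebesgue)"
  proof (rule nn_integral_mono)
    fix y :: real
    show "ennreal y * indicator (thin_set \<inter> {..b}) y
        \<le> (\<Sum>k\<le>n. ennreal (2 ^ k + 1) * indicator {2 ^ k..2 ^ k + 1} y)"
    proof (cases "y \<in> thin_set \<inter> {..b}")
      case y: True
      then obtain k where k: "y \<in> {2 ^ k..2 ^ k + 1}" by (auto simp: thin_set_def)
      have "(2::real) ^ k < 2 ^ Suc n" using k y n by simp
      hence "k \<le> n" by (simp add: power_strict_increasing_iff del: power_Suc)
      hence "ennreal (2 ^ k + 1) * indicator {2 ^ k..2 ^ k + 1} y
          \<le> (\<Sum>k\<le>n. ennreal (2 ^ k + 1) * indicator {2 ^ k..2 ^ k + 1} y)"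
        by (intro member_le_sum) auto
      moreover have "ennreal y \<le> ennreal (2 ^ k + 1)" using k by (intro ennreal_leI) simp
      ultimately show ?thesis using y k by simp
    qed simp
  qed
  also have "\<dots> = (\<Sum>k\<le>n. ennreal (2 ^ k + 1))"
    by (subst nn_integral_sum) (auto simp: nn_integral_cmult_indicator)
  also have "\<dots> = ennreal (\<Sum>k\<le>n. 2 ^ k + 1)" by (rule sum_ennreal) simp
  also have "(\<Sum>k\<le>n. 2 ^ k + 1 :: real) \<le> (\<Sum>k\<le>n. 2 * 2 ^ k)"
    by (intro sum_mono) simp
  also have "\<dots> = 2 * (2 ^ Suc n - 1)"
    by (simp only: sum_distrib_left[symmetric] lessThan_Suc_atMost[symmetric] geometric_sum) (simp add: geometric_sum)
  also have "\<dots> \<le> 4 * b" using n by simp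
  finally show ?thesis by (simp add: ennreal_leI)
qed

section \<open>The maximal operator is bounded\<close>

text \<open>The function \<open>\<bar>f\<bar> * u powr (1 / p)\<close> for the thin weight \<open>u\<close>; its unweighted norm is the weighted
  norm of \<open>f\<close>.\<close>

definition reduced :: "(real \<Rightarrow> real) \<Rightarrow> real \<Rightarrow> real" where
  "reduced f y = (if y \<in> thin_set then \<bar>f y\<bar> / y else 0)"

lemma reduced_nonneg: "0 \<le> reduced f y"
  using thin_set_ge_1[of y] by (auto simp: reduced_def)

lemma reduced_measurable:
  assumes [measurable]: "f \<in> borel_measurable lebesgue"
  shows "reduced f \<in> borel_measurable lebesgue"
proof -
  show ?thesis unfolding reduced_def by measurable
qed

lemma reduced_powr: "\<bar>reduced f y\<bar> powr p = \<bar>f y\<bar> powr p * thin_weight p y"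
  using thin_set_ge_1[of y] reduced_nonneg[of f y]
  by (auto simp: reduced_def thin_weight_def powr_divide powr_minus_divide)

text \<open>A substitute for Hoelder's inequality: integrated against a measure, it bounds an integral of \<open>g\<close> by the
  mass and the \<open>p\<close>-th power integral, and \<open>N\<close> can be chosen to balance them.\<close>

lemma le_add_powr:
  assumes "1 \<le> p" "0 < N" "0 \<le> (g::real)"
  shows "g \<le> N + N powr (1 - p) * g powr p"
proof (cases "g \<le> N")
  case False
  hence g: "N < g" "0 < g" using assms by auto
  have "1 \<le> (g / N) powr (p - 1)" using g assms by (intro ge_one_powr_ge_zero) auto
  hence "g * 1 \<le> g * (g / N) powr (p - 1)" using g by (intro mult_left_mono) auto
  also have "\<dots> = N powr (1 - p) * g powr p"
    using g assms by (simp add: powr_divide powr_diff field_simps)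
  finally show ?thesis using assms by simp
qed (use assms in \<open>simp add: add_increasing2\<close>)

text \<open>The key estimate. Given an interval around \<open>x\<close>, cut it at \<open>2 * x\<close>. Left of the cut
  \<open>\<bar>f y\<bar> \<le> 2 * x * reduced f y\<close>, which leads to the unweighted maximal function. If the
  interval reaches beyond the cut to some \<open>d\<close>, its length is at least \<open>d / 2\<close>, and the first-moment bound
  shows that all of \<open>f\<close> on \<open>{..d}\<close> has mass of order \<open>d\<close> times the norm of \<open>f\<close>. So far-away
  blocks, however many, raise the maximal function by a constant only.\<close>

lemma maximal_function_thin_le:
  assumes p: "1 < p" and [measurable]: "f \<in> borel_measurable lebesgue"
    and supp: "AE y in lebesgue. y \<notin> thin_set \<longrightarrow> f y = 0"
    and m: "0 < m" "(\<integral>\<^sup>+y. ennreal (\<bar>reduced f y\<bar> powr p) \<partial>lebesgue) \<le> ennreal m"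
    and x: "x \<in> thin_set"
  shows "maximal_function f x
    \<le> ennreal (2 * x) * maximal_function (reduced f) x + ennreal (10 * m powr (1 / p))"
proof (rule maximal_function_le)
  fix c d assume cd: "c < x" "x < d"
  define N where "N = m powr (1 / p)"
  have N: "0 < N" using m by (simp add: N_def)
  \<comment> \<open>\<open>N\<close> is at least the norm of \<open>reduced f\<close>, and this choice balances the two terms of \<open>le_add_powr\<close>.\<close>
  have Nm: "N powr (1 - p) * m = N"
  proof -
    have "N powr (1 - p) * m = m powr (1 / p * (1 - p)) * m powr 1"
      using m by (simp add: N_def powr_powr)
    also have "\<dots> = m powr (1 / p * (1 - p) + 1)" by (simp only: powr_add)
    also have "1 / p * (1 - p) + 1 = 1 / p" using p by (simp add: field_simps)
    finally show ?thesis by (simp only: N_def)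
  qed
  have x1: "1 \<le> x" using thin_set_ge_1[OF x] .
  note [measurable] = reduced_measurable[OF assms(2)]
  let ?g = "reduced f"
  let ?far = "\<integral>\<^sup>+y. ennreal (y * ?g y) * indicator (thin_set \<inter> {2 * x<..d}) y \<partial>lebesgue"
  have "(\<integral>\<^sup>+y\<in>{c..d}. ennreal \<bar>f y\<bar> \<partial>lebesgue)
      \<le> (\<integral>\<^sup>+y. ennreal (2 * x) * (ennreal \<bar>?g y\<bar> * indicator {c..d} y)
            + ennreal (y * ?g y) * indicator (thin_set \<inter> {2 * x<..d}) y \<partial>lebesgue)"
  proof (rule nn_integral_mono_AE, use supp in eventually_elim)
    fix y assume f0: "y \<notin> thin_set \<longrightarrow> f y = 0"
    show "ennreal \<bar>f y\<bar> * indicator {c..d} y \<le> ennreal (2 * x) * (ennreal \<bar>?g y\<bar> * indicator {c..d} y)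
            + ennreal (y * ?g y) * indicator (thin_set \<inter> {2 * x<..d}) y"
    proof (cases "y \<in> thin_set \<and> y \<in> {c..d}")
      case True
      hence y: "\<bar>f y\<bar> = y * ?g y" using thin_set_ge_1[of y] by (simp add: reduced_def)
      show ?thesis
      proof (cases "y \<le> 2 * x")
        case le: True
        have "y * ?g y \<le> 2 * x * ?g y" using le reduced_nonneg by (intro mult_right_mono) auto
        hence "ennreal (y * ?g y) \<le> ennreal (2 * x) * ennreal \<bar>?g y\<bar>"
          using x1 reduced_nonneg[of f y] by (subst ennreal_mult[symmetric]) (auto intro!: ennreal_leI)
        thus ?thesis using True le y by simp
      qed (use True y in simp)
    qed (use f0 in \<open>auto simp: indicator_def\<close>)
  qed
  also have "\<dots> = ennreal (2 * x) * (\<integral>\<^sup>+y\<in>{c..d}. ennreal \<bar>?g y\<bar> \<partial>lebesgue) + ?far"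
    by (subst nn_integral_add) (auto simp: nn_integral_cmult)
  also have "\<dots> \<le> ennreal (2 * x) * (maximal_function ?g x * ennreal (d - c)) + ennreal (10 * N) * ennreal (d - c)"
  proof (intro add_mono mult_left_mono maximal_function_ge)
    show "?far \<le> ennreal (10 * N) * ennreal (d - c)"
    proof (cases "d \<le> 2 * x")
      case True
      thus ?thesis by simp
    next
      case False
      have d: "0 < d" using cd x1 by simp
      let ?k = "d * N powr (1 - p)"
      have k: "0 \<le> ?k" using d by simp
      have "?far \<le> (\<integral>\<^sup>+y. ennreal N * (ennreal y * indicator (thin_set \<inter> {..d}) y)
            + ennreal ?k * ennreal (\<bar>?g y\<bar> powr p) \<partial>lebesgue)"
      proof (rule nn_integral_mono)
        fix y :: real
        show "ennreal (y * ?g y) * indicator (thin_set \<inter> {2 * x<..d}) y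
            \<le> ennreal N * (ennreal y * indicator (thin_set \<inter> {..d}) y)
            + ennreal ?k * ennreal (\<bar>?g y\<bar> powr p)"
        proof (cases "y \<in> thin_set \<inter> {2 * x<..d}")
          case True
          hence y: "0 \<le> y" "y \<le> d" using x1 by auto
          have "y * ?g y \<le> y * (N + N powr (1 - p) * ?g y powr p)"
            using y le_add_powr[of p N "?g y"] p N reduced_nonneg by (intro mult_left_mono) auto
          also have "\<dots> = N * y + y * (N powr (1 - p) * ?g y powr p)" by (simp add: algebra_simps)
          also have "\<dots> \<le> N * y + d * (N powr (1 - p) * ?g y powr p)"
            using y by (intro add_left_mono mult_right_mono) auto
          finally have "y * ?g y \<le> N * y + ?k * \<bar>?g y\<bar> powr p"
            using reduced_nonneg[of f y] by (simp add: mult.assoc)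
          hence "ennreal (y * ?g y) \<le> ennreal (N * y + ?k * \<bar>?g y\<bar> powr p)" by (rule ennreal_leI)
          also have "\<dots> = ennreal N * ennreal y + ennreal ?k * ennreal (\<bar>?g y\<bar> powr p)"
            by (simp only: ennreal_plus ennreal_mult y k less_imp_le[OF N] powr_ge_zero mult_nonneg_nonneg)
          finally show ?thesis using True by simp
        qed simp
      qed
      also have "\<dots> = ennreal N * (\<integral>\<^sup>+y. ennreal y * indicator (thin_set \<inter> {..d}) y \<partial>lebesgue)
          + ennreal ?k * (\<integral>\<^sup>+y. ennreal (\<bar>?g y\<bar> powr p) \<partial>lebesgue)"
        by (subst nn_integral_add) (auto simp: nn_integral_cmult)
      also have "\<dots> \<le> ennreal N * ennreal (4 * d) + ennreal ?k * ennreal m"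
        using d by (intro add_mono mult_left_mono thin_set_first_moment m) auto
      also have "\<dots> = ennreal (4 * N * d + ?k * m)"
      proof -
        have "ennreal N * ennreal (4 * d) = ennreal (4 * N * d)"
          using N d by (subst ennreal_mult[symmetric]) (auto simp: mult_ac)
        moreover have "ennreal ?k * ennreal m = ennreal (?k * m)"
          using k m by (intro ennreal_mult[symmetric]) auto
        ultimately show ?thesis
          using N d m k by (simp only:) (intro ennreal_plus[symmetric] mult_nonneg_nonneg, auto)
      qed
      also have "4 * N * d + ?k * m = 5 * N * d"
        by (simp only: mult.assoc Nm) simp
      \<comment> \<open>\<open>d < 2 * (d - c)\<close>, as \<open>c < x\<close> and \<open>2 * x < d\<close>.\<close>
      also have "5 * N * d \<le> 10 * N * (d - c)"
        using False cd N by (simp add: algebra_simps)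
      finally show ?thesis
        using N cd by (subst ennreal_mult[symmetric]) (auto intro: ennreal_leI)
    qed
  qed (use cd in auto)
  also have "\<dots> = (ennreal (2 * x) * maximal_function ?g x + ennreal (10 * N)) * ennreal (d - c)"
    by (simp add: distrib_right mult.assoc)
  finally show "(\<integral>\<^sup>+y\<in>{c..d}. ennreal \<bar>f y\<bar> \<partial>lebesgue)
      \<le> (ennreal (2 * x) * maximal_function ?g x + ennreal (10 * m powr (1 / p))) * ennreal (d - c)"
    unfolding N_def .
qed

lemma Lp_norm_abs:
  assumes "\<And>x. 0 \<le> u x"
  shows "Lp_norm p u (\<lambda>x. ennreal \<bar>f x\<bar>) = ennpowr (\<integral>\<^sup>+x. ennreal (\<bar>f x\<bar> powr p * u x) \<partial>lebesgue) (1 / p)"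
  unfolding Lp_norm_def using assms by (simp add: ennpowr_ennreal ennreal_mult)

text \<open>In the key estimate the factor \<open>2 * x\<close> turns the weight \<open>x powr (- p)\<close> into a constant, which leaves
  the unweighted maximal theorem for \<open>reduced f\<close>; the additive constant is harmless because the
  weight has finite mass.\<close>

lemma maximal_thin_strong_type:
  assumes p: "1 < p" and f: "f \<in> Lp_space p (thin_weight p)"
  shows "(\<integral>\<^sup>+x. ennpowr (maximal_function f x) p * ennreal (thin_weight p x) \<partial>lebesgue)
    \<le> ennreal (4 powr p * (10 * p / (p - 1) * 2 powr (p - 1)) + 20 powr p / (p - 1))
      * (\<integral>\<^sup>+x. ennreal (\<bar>f x\<bar> powr p * thin_weight p x) \<partial>lebesgue)"
proof -
  let ?u = "thin_weight p" and ?g = "reduced f"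
  let ?A = "10 * p / (p - 1) * 2 powr (p - 1)"
  let ?K = "4 powr p * ?A + 20 powr p / (p - 1)"
  let ?L = "\<integral>\<^sup>+x. ennpowr (maximal_function f x) p * ennreal (?u x) \<partial>lebesgue"
  have A: "0 \<le> ?A" using p by simp
  have fm: "f \<in> borel_measurable lebesgue" using f by (simp add: Lp_space_def)
  have supp: "AE y in lebesgue. y \<notin> thin_set \<longrightarrow> f y = 0"
    using f by (auto simp: Lp_space_def thin_weight_def elim!: eventually_mono)
  have gf: "(\<integral>\<^sup>+x. ennreal (\<bar>?g x\<bar> powr p) \<partial>lebesgue) = (\<integral>\<^sup>+x. ennreal (\<bar>f x\<bar> powr p * ?u x) \<partial>lebesgue)"
    by (simp only: reduced_powr)
  obtain F where F: "(\<integral>\<^sup>+x. ennreal (\<bar>f x\<bar> powr p * ?u x) \<partial>lebesgue) = ennreal F" "0 \<le> F"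
    using f unfolding Lp_space_def by (cases "\<integral>\<^sup>+x. ennreal (\<bar>f x\<bar> powr p * ?u x) \<partial>lebesgue") auto
  have [measurable]: "maximal_function ?g \<in> borel_measurable lebesgue"
    by (intro measurable_completion) simp
  have [measurable]: "(\<lambda>x. ennpowr (maximal_function ?g x) p) \<in> borel_measurable lebesgue"
    using p by (intro measurable_compose[OF _ ennpowr_measurable]) auto
  have um [measurable]: "?u \<in> borel_measurable lebesgue"
    by (intro measurable_completion) simp
  \<comment> \<open>The key estimate wants a positive bound \<open>m\<close>, whereas \<open>F\<close> may be 0; at the end \<open>m\<close> decreases to \<open>F\<close>.\<close>
  have bound: "?L \<le> ennreal (?K * m)" if m: "0 < m" "F \<le> m" for m
  proof -
    have gm: "(\<integral>\<^sup>+y. ennreal (\<bar>?g y\<bar> powr p) \<partial>lebesgue) \<le> ennreal m"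
      unfolding gf F using m by (simp add: ennreal_leI)
    let ?N = "10 * m powr (1 / p)"
    have "?L \<le> (\<integral>\<^sup>+x. ennreal (4 powr p) * ennpowr (maximal_function ?g x) p
                   + ennreal (20 powr p * m) * ennreal (?u x) \<partial>lebesgue)"
    proof (rule nn_integral_mono)
      fix x :: real
      show "ennpowr (maximal_function f x) p * ennreal (?u x)
          \<le> ennreal (4 powr p) * ennpowr (maximal_function ?g x) p + ennreal (20 powr p * m) * ennreal (?u x)"
      proof (cases "x \<in> thin_set")
        case x: True
        have x1: "1 \<le> x" using thin_set_ge_1[OF x] .
        have u: "?u x = x powr (- p)" using x by (simp add: thin_weight_def)
        have "ennpowr (maximal_function f x) p
            \<le> ennpowr (ennreal (2 * x) * maximal_function ?g x + ennreal ?N) p"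
          using p by (intro ennpowr_mono maximal_function_thin_le[OF p fm supp m(1) gm x]) auto
        also have "\<dots> \<le> ennreal (2 powr p) * (ennpowr (ennreal (2 * x) * maximal_function ?g x) p + ennpowr (ennreal ?N) p)"
          using p by (intro ennpowr_add_le) auto
        also have "ennpowr (ennreal (2 * x) * maximal_function ?g x) p
            = ennreal ((2 * x) powr p) * ennpowr (maximal_function ?g x) p"
          using x1 p by (intro ennpowr_mult) auto
        also have "ennpowr (ennreal ?N) p = ennreal (10 powr p * m)"
          using m p by (simp add: ennpowr_ennreal powr_mult powr_powr)
        finally have "ennpowr (maximal_function f x) p * ennreal (?u x)
            \<le> ennreal (2 powr p) * (ennreal ((2 * x) powr p) * ennpowr (maximal_function ?g x) p
                 + ennreal (10 powr p * m)) * ennreal (?u x)"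
          by (rule mult_right_mono) simp
        also have "\<dots> = (ennreal (2 powr p) * ennreal ((2 * x) powr p) * ennreal (?u x)) * ennpowr (maximal_function ?g x) p
                 + (ennreal (2 powr p) * ennreal (10 powr p * m)) * ennreal (?u x)"
          by (simp only: distrib_left distrib_right mult_ac)
        also have "ennreal (2 powr p) * ennreal ((2 * x) powr p) * ennreal (?u x)
            = ennreal (2 powr p * (2 * x) powr p * ?u x)"
          by (simp only: ennreal_mult powr_ge_zero thin_weight_nonneg mult_nonneg_nonneg)
        also have "2 powr p * (2 * x) powr p * ?u x = 4 powr p"
          using x1 unfolding u by (simp add: powr_mult[symmetric] powr_minus field_simps)
        also have "ennreal (2 powr p) * ennreal (10 powr p * m) = ennreal (2 powr p * (10 powr p * m))"
          using m by (simp only: ennreal_mult powr_ge_zero mult_nonneg_nonneg less_imp_le)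
        also have "2 powr p * (10 powr p * m) = 20 powr p * m"
          by (simp add: powr_mult[symmetric] mult.assoc[symmetric])
        finally show ?thesis .
      qed (simp add: thin_weight_def)
    qed
    also have "\<dots> = ennreal (4 powr p) * (\<integral>\<^sup>+x. ennpowr (maximal_function ?g x) p \<partial>lebesgue)
        + ennreal (20 powr p * m) * (\<integral>\<^sup>+x. ennreal (?u x) \<partial>lebesgue)"
      using um by (subst nn_integral_add) (auto simp: nn_integral_cmult)
    also have "\<dots> \<le> ennreal (4 powr p) * (ennreal ?A * ennreal m) + ennreal (20 powr p * m) * ennreal (1 / (p - 1))"
    proof (intro add_mono mult_left_mono thin_weight_mass p)
      have "(\<integral>\<^sup>+x. ennpowr (maximal_function ?g x) p \<partial>lebesgue)
          \<le> ennreal ?A * (\<integral>\<^sup>+x. ennreal (\<bar>?g x\<bar> powr p) \<partial>lebesgue)"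
        by (rule maximal_strong_type[OF p reduced_measurable[OF fm]])
      also have "\<dots> \<le> ennreal ?A * ennreal m" by (intro mult_left_mono gm) simp
      finally show "(\<integral>\<^sup>+x. ennpowr (maximal_function ?g x) p \<partial>lebesgue) \<le> ennreal ?A * ennreal m" .
    qed auto
    also have "\<dots> = ennreal (4 powr p * (?A * m)) + ennreal (20 powr p * m * (1 / (p - 1)))"
      using A m p by (simp only: ennreal_mult powr_ge_zero mult_nonneg_nonneg less_imp_le divide_nonneg_nonneg)
    also have "\<dots> = ennreal (4 powr p * (?A * m) + 20 powr p * m * (1 / (p - 1)))"
      using A m p by (intro ennreal_plus[symmetric]) auto
    also have "4 powr p * (?A * m) + 20 powr p * m * (1 / (p - 1)) = ?K * m"
      by (simp add: algebra_simps)
    finally show ?thesis .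
  qed
  have K: "0 < ?K" using p by (intro add_nonneg_pos mult_nonneg_nonneg A) auto
  have "?L \<le> ennreal ?K * ennreal F"
  proof (rule ennreal_le_epsilon)
    fix e :: real assume e: "0 < e"
    have "0 < e / ?K" using e K by (rule divide_pos_pos)
    hence "?L \<le> ennreal (?K * (F + e / ?K))"
      using F(2) by (intro bound) linarith+
    also have "?K * (F + e / ?K) = ?K * F + e" using K by (simp only: distrib_left) simp
    also have "ennreal (?K * F + e) = ennreal ?K * ennreal F + ennreal e"
      using K F e by (simp only: ennreal_plus ennreal_mult mult_nonneg_nonneg less_imp_le)
    finally show "?L \<le> ennreal ?K * ennreal F + ennreal e" .
  qed
  thus ?thesis unfolding F .
qed

lemma maximal_bounded_thin_weight:
  assumes p: "1 < p"
  shows "maximal_bounded p (thin_weight p)"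
  unfolding maximal_bounded_def
proof (intro exI conjI ballI)
  let ?K = "4 powr p * (10 * p / (p - 1) * 2 powr (p - 1)) + 20 powr p / (p - 1)"
  have K: "0 < ?K" using p by (intro add_nonneg_pos) auto
  show "0 \<le> ?K powr (1 / p)" by simp
  fix f assume f: "f \<in> Lp_space p (thin_weight p)"
  let ?F = "\<integral>\<^sup>+x. ennreal (\<bar>f x\<bar> powr p * thin_weight p x) \<partial>lebesgue"
  have "Lp_norm p (thin_weight p) (maximal_function f) \<le> ennpowr (ennreal ?K * ?F) (1 / p)"
    unfolding Lp_norm_def using p by (intro ennpowr_mono maximal_thin_strong_type f) auto
  also have "\<dots> = ennreal (?K powr (1 / p)) * ennpowr ?F (1 / p)"
    using K p by (intro ennpowr_mult) auto
  finally show "Lp_norm p (thin_weight p) (maximal_function f)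
      \<le> ennreal (?K powr (1 / p)) * Lp_norm p (thin_weight p) (\<lambda>x. ennreal \<bar>f x\<bar>)"
    by (simp only: Lp_norm_abs thin_weight_nonneg)
qed

section \<open>The Hilbert transform of step functions\<close>

text \<open>Near \<open>x\<close> the kernel is odd about \<open>x\<close>, so a function constant on the \<open>\<delta>\<close>-neighbourhood of \<open>x\<close>
  contributes nothing there: the truncated integrals do not change once \<open>\<epsilon> < \<delta>\<close>. This gives
  existence of the principal value and a formula for it at once.\<close>

lemma has_hilbert_transform_locally_constant:
  fixes f :: "real \<Rightarrow> real"
  assumes f: "integrable lebesgue f" and d: "0 < \<delta>"
    and const: "\<And>y. \<bar>y - x\<bar> \<le> \<delta> \<Longrightarrow> f y = f x"
  shows "has_hilbert_transform f x (LINT y:{y. \<delta> < \<bar>y - x\<bar>}|lebesgue. f y / (y - x))"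
proof -
  have [measurable]: "f \<in> borel_measurable lebesgue" using f by auto
  have trunc: "set_integrable lebesgue {y. \<epsilon> < \<bar>y - x\<bar>} (\<lambda>y. f y / (y - x))" if "0 < \<epsilon>" for \<epsilon>
    unfolding set_integrable_def
  proof (rule Bochner_Integration.integrable_bound)
    show "integrable lebesgue (\<lambda>y. f y / \<epsilon>)" using f by simp
    show "AE y in lebesgue. norm (indicat_real {y. \<epsilon> < \<bar>y - x\<bar>} y *\<^sub>R (f y / (y - x))) \<le> norm (f y / \<epsilon>)"
      using that by (auto simp: indicator_def abs_divide intro!: divide_left_mono)
  qed measurable
  have "(LINT y:{y. \<epsilon> < \<bar>y - x\<bar>}|lebesgue. f y / (y - x)) =
        (LINT y:{y. \<delta> < \<bar>y - x\<bar>}|lebesgue. f y / (y - x))" if e: "0 < \<epsilon>" "\<epsilon> < \<delta>" for \<epsilon>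
  proof -
    let ?A = "{y. \<epsilon> < \<bar>y - x\<bar> \<and> \<bar>y - x\<bar> \<le> \<delta>}"
    let ?F = "\<lambda>y. indicator ?A y * (1 / (y - x)) :: real"
    have "?A = {x - \<delta>..<x - \<epsilon>} \<union> {x + \<epsilon><..x + \<delta>}" using e by auto
    hence A: "?A \<in> sets borel" by simp
    \<comment> \<open>Reflection in the point \<open>x\<close>.\<close>
    have "(LINT y|lborel. ?F y) = (LINT y|lborel. ?F (2 * x + - 1 * y))"
      using lborel_integral_real_affine[of "- 1" ?F "2 * x"] by simp
    also have "\<dots> = (LINT y|lborel. - ?F y)"
    proof (rule Bochner_Integration.integral_cong)
      fix y
      have "\<bar>2 * x + - 1 * y - x\<bar> = \<bar>y - x\<bar>" "2 * x + - 1 * y - x = - (y - x)" by auto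
      thus "?F (2 * x + - 1 * y) = - ?F y" by (simp add: indicator_def divide_simps)
    qed simp
    also have "\<dots> = - (LINT y|lborel. ?F y)" by (rule Bochner_Integration.integral_minus)
    finally have "(LINT y|lborel. ?F y) = 0" by linarith
    moreover have "(LINT y|lebesgue. ?F y) = (LINT y|lborel. ?F y)"
      using A by (intro integral_completion borel_measurable_times borel_measurable_indicator) auto
    ultimately have odd: "(LINT y|lebesgue. ?F y) = 0" by (rule trans[rotated])
    have "(LINT y:?A|lebesgue. f y / (y - x)) = (LINT y|lebesgue. f x * ?F y)"
      unfolding set_lebesgue_integral_def
    proof (rule Bochner_Integration.integral_cong)
      fix y
      show "indicat_real ?A y *\<^sub>R (f y / (y - x)) = f x * ?F y"
      proof (cases "y \<in> ?A")
        case True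
        hence "f y = f x" by (intro const) auto
        thus ?thesis by simp
      qed simp
    qed simp
    also have "\<dots> = f x * (LINT y|lebesgue. ?F y)"
      by (rule integral_mult_right_zero)
    finally have ann: "(LINT y:?A|lebesgue. f y / (y - x)) = 0" unfolding odd by (simp only: mult_zero_right)
    have un: "{y. \<epsilon> < \<bar>y - x\<bar>} = ?A \<union> {y. \<delta> < \<bar>y - x\<bar>}" using e by auto
    have "(LINT y:?A \<union> {y. \<delta> < \<bar>y - x\<bar>}|lebesgue. f y / (y - x))
        = (LINT y:?A|lebesgue. f y / (y - x)) + (LINT y:{y. \<delta> < \<bar>y - x\<bar>}|lebesgue. f y / (y - x))"
    proof (rule set_integral_Un)
      show "set_integrable lebesgue ?A (\<lambda>y. f y / (y - x))"
        using A by (intro set_integrable_subset[OF trunc[OF e(1)]]) auto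
      show "set_integrable lebesgue {y. \<delta> < \<bar>y - x\<bar>} (\<lambda>y. f y / (y - x))"
        by (rule trunc[OF d])
    qed auto
    thus ?thesis unfolding un ann by (simp only: add_0)
  qed
  hence "\<forall>\<epsilon>>0. \<epsilon> < \<delta> \<longrightarrow> (LINT y:{y. \<epsilon> < \<bar>y - x\<bar>}|lebesgue. f y / (y - x)) =
        (LINT y:{y. \<delta> < \<bar>y - x\<bar>}|lebesgue. f y / (y - x))"
    by blast
  hence "eventually (\<lambda>\<epsilon>. (LINT y:{y. \<epsilon> < \<bar>y - x\<bar>}|lebesgue. f y / (y - x)) =
        (LINT y:{y. \<delta> < \<bar>y - x\<bar>}|lebesgue. f y / (y - x))) (at_right 0)"
    unfolding eventually_at_right_field using d by blast
  hence "((\<lambda>\<epsilon>. LINT y:{y. \<epsilon> < \<bar>y - x\<bar>}|lebesgue. f y / (y - x)) \<longlongrightarrow>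
        (LINT y:{y. \<delta> < \<bar>y - x\<bar>}|lebesgue. f y / (y - x))) (at_right 0)"
    by (rule tendsto_eventually)
  thus ?thesis unfolding has_hilbert_transform_def by (intro conjI allI impI trunc)
qed

lemma hilbert_transform_eqI:
  assumes "has_hilbert_transform f x h"
  shows "hilbert_transform f x = h"
  unfolding hilbert_transform_def
proof (rule the_equality)
  let ?T = "\<lambda>\<epsilon>. LINT y:{y. \<epsilon> < \<bar>y - x\<bar>}|lebesgue. f y / (y - x)"
  fix h' assume "has_hilbert_transform f x h'"
  hence "(?T \<longlongrightarrow> h') (at_right 0)" unfolding has_hilbert_transform_def by (rule conjunct2)
  moreover have "(?T \<longlongrightarrow> h) (at_right 0)"
    using assms unfolding has_hilbert_transform_def by (rule conjunct2)
  ultimately show "h' = h" by (rule tendsto_unique[OF trivial_limit_at_right_real])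
qed (rule assms)

text \<open>A step function close to the identity on the blocks number \<open>2\<close> to \<open>n + 1\<close>, hence one whose
  quotient by \<open>y\<close> is about \<open>1\<close> on a set of measure \<open>n\<close>. A step function is preferred to the identity
  because it is locally constant off finitely many points; the blocks number \<open>0\<close> and \<open>1\<close> are left
  free so that the support keeps away from \<open>{1..2}\<close>.\<close>

definition staircase :: "nat \<Rightarrow> real \<Rightarrow> real" where
  "staircase n y = (\<Sum>k\<in>{2..<n + 2}. 2 ^ k * indicator {2 ^ k..2 ^ k + 1} y)"

lemma staircase_integrable: "integrable lebesgue (staircase n)"
  unfolding staircase_def by (intro Bochner_Integration.integrable_sum integrable_mult_right) auto

lemma eventually_indicator_interval_eq:
  fixes a b x :: real
  assumes "x \<noteq> a" "x \<noteq> b"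
  shows "eventually (\<lambda>y. indicator {a..b} y = (indicator {a..b} x :: real)) (nhds x)"
proof (cases "x \<in> {a..b}")
  case True
  hence "eventually (\<lambda>y. y \<in> {a<..<b}) (nhds x)"
    using assms by (intro eventually_nhds_in_open) auto
  thus ?thesis by (rule eventually_mono) (use True in auto)
next
  case False
  hence "eventually (\<lambda>y. y \<in> - {a..b}) (nhds x)" by (intro eventually_nhds_in_open) auto
  thus ?thesis by (rule eventually_mono) (use False in auto)
qed

lemma staircase_has_hilbert_transform:
  "AE x in lebesgue. \<exists>h. has_hilbert_transform (staircase n) x h"
proof -
  let ?N = "\<Union>k\<in>{2..<n + 2}. {2 ^ k, 2 ^ k + 1 :: real}"
  have "?N \<in> null_sets lebesgue"
    by (intro null_sets_completionI finite_imp_null_set_lborel) auto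
  hence "AE x in lebesgue. x \<notin> ?N" by (rule AE_not_in)
  thus ?thesis
  proof (rule eventually_mono)
    fix x assume x: "x \<notin> ?N"
    have "eventually (\<lambda>y. \<forall>k\<in>{2..<n + 2}.
        indicator {2 ^ k..2 ^ k + 1} y = (indicator {2 ^ k..2 ^ k + 1} x :: real)) (nhds x)"
      using x by (intro eventually_ball_finite ballI eventually_indicator_interval_eq) auto
    hence "eventually (\<lambda>y. staircase n y = staircase n x) (nhds x)"
      unfolding staircase_def by eventually_elim (auto intro: sum.cong)
    then obtain d where d: "0 < d" "\<And>y. dist y x < d \<Longrightarrow> staircase n y = staircase n x"
      unfolding eventually_nhds_metric by auto
    have "has_hilbert_transform (staircase n) x (LINT y:{y. d / 2 < \<bar>y - x\<bar>}|lebesgue. staircase n y / (y - x))"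
    proof (rule has_hilbert_transform_locally_constant[OF staircase_integrable])
      show "0 < d / 2" using d(1) by simp
      fix y assume "\<bar>y - x\<bar> \<le> d / 2"
      thus "staircase n y = staircase n x" using d(1) by (intro d(2)) (simp add: dist_real_def)
    qed
    thus "\<exists>h. has_hilbert_transform (staircase n) x h" ..
  qed
qed

text \<open>Seen from \<open>{1..2}\<close> the function lies entirely to the right, so nothing cancels, and each block
  contributes at least \<open>1\<close>: the height \<open>2 ^ k\<close> makes up for the distance, at most \<open>2 ^ k\<close>.\<close>

lemma staircase_hilbert_transform_ge:
  assumes x: "1 \<le> x" "x \<le> 2"
  shows "real n \<le> hilbert_transform (staircase n) x"
proof -
  have big: "4 \<le> y" if "k \<in> {2..<n + 2}" "2 ^ k \<le> y" for k and y :: real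
  proof -
    have "(2::real) ^ 2 \<le> 2 ^ k" using that by (intro power_increasing) auto
    thus ?thesis using that by simp
  qed
  have zero: "staircase n y = 0" if "y < 4" for y
    unfolding staircase_def
  proof (intro sum.neutral ballI)
    fix k assume k: "k \<in> {2..<n + 2}"
    have "y \<notin> {2 ^ k..2 ^ k + 1}" using big[OF k, of y] that by auto
    thus "2 ^ k * indicat_real {2 ^ k..2 ^ k + 1} y = 0" by simp
  qed
  have h: "has_hilbert_transform (staircase n) x (LINT y:{y. 1 < \<bar>y - x\<bar>}|lebesgue. staircase n y / (y - x))"
    using x by (intro has_hilbert_transform_locally_constant staircase_integrable) (auto simp: zero)
  have "real n = (LINT y|lebesgue. (\<Sum>k\<in>{2..<n + 2}. indicator {2 ^ k..2 ^ k + 1 :: real} y))"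
    by (subst Bochner_Integration.integral_sum) auto
  also have "\<dots> \<le> (LINT y:{y. 1 < \<bar>y - x\<bar>}|lebesgue. staircase n y / (y - x))"
    unfolding set_lebesgue_integral_def
  proof (rule integral_mono)
    show "integrable lebesgue (\<lambda>y. \<Sum>k\<in>{2..<n + 2}. indicat_real {2 ^ k..2 ^ k + 1 :: real} y)"
      by (intro Bochner_Integration.integrable_sum) auto
    show "integrable lebesgue (\<lambda>y. indicat_real {y. 1 < \<bar>y - x\<bar>} y *\<^sub>R (staircase n y / (y - x)))"
      using h by (simp add: has_hilbert_transform_def set_integrable_def)
    fix y :: real
    show "(\<Sum>k\<in>{2..<n + 2}. indicat_real {2 ^ k..2 ^ k + 1 :: real} y)
        \<le> indicat_real {y. 1 < \<bar>y - x\<bar>} y *\<^sub>R (staircase n y / (y - x))"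
    proof (cases "y < 4")
      case True
      have "(\<Sum>k\<in>{2..<n + 2}. indicat_real {2 ^ k..2 ^ k + 1 :: real} y) = 0"
      proof (intro sum.neutral ballI)
        fix k assume k: "k \<in> {2..<n + 2}"
        have "y \<notin> {2 ^ k..2 ^ k + 1}" using big[OF k, of y] True by auto
        thus "indicat_real {2 ^ k..2 ^ k + 1} y = 0" by (rule indicator_simps)
      qed
      thus ?thesis using zero[OF True] by simp
    next
      case False
      have "(\<Sum>k\<in>{2..<n + 2}. indicat_real {2 ^ k..2 ^ k + 1 :: real} y)
          \<le> (\<Sum>k\<in>{2..<n + 2}. 2 ^ k * indicator {2 ^ k..2 ^ k + 1} y / (y - x))"
        using False x by (intro sum_mono) (auto simp: indicator_def divide_simps)
      also have "\<dots> = staircase n y / (y - x)" unfolding staircase_def sum_divide_distrib ..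
      finally show ?thesis using False x by simp
    qed
  qed
  finally show ?thesis using hilbert_transform_eqI[OF h] by simp
qed

section \<open>The Hilbert transform is unbounded\<close>

text \<open>The blocks with index at least 1 are disjoint, so the heights do not add up.\<close>

lemma staircase_eq:
  assumes k: "k \<in> {2..<n + 2}" and y: "y \<in> {2 ^ k..2 ^ k + 1}"
  shows "staircase n y = 2 ^ k"
proof -
  have gap: "False" if "2 \<le> i" "i < j" "y \<le> 2 ^ i + 1" "2 ^ j \<le> y" for i j
  proof -
    have "(2::real) ^ 1 \<le> 2 ^ i" using that by (intro power_increasing) auto
    moreover have "(2::real) ^ Suc i \<le> 2 ^ j" using that by (intro power_increasing) auto
    ultimately show False using that by simp
  qed
  have "2 ^ j * indicator {2 ^ j..2 ^ j + 1} y = (if j = k then 2 ^ k else 0 :: real)"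
    if "j \<in> {2..<n + 2}" for j
    using gap[of j k] gap[of k j] k y that by (cases j k rule: linorder_cases) (auto simp: indicator_def)
  hence "staircase n y = (\<Sum>j\<in>{2..<n + 2}. if j = k then 2 ^ k else 0)"
    unfolding staircase_def by (intro sum.cong) auto
  thus ?thesis using k by simp
qed

lemma staircase_thin_norm:
  assumes p: "1 < p"
  shows "(\<integral>\<^sup>+x. ennreal (\<bar>staircase n x\<bar> powr p * thin_weight p x) \<partial>lebesgue) \<le> ennreal (real n)"
proof -
  have "(\<integral>\<^sup>+x. ennreal (\<bar>staircase n x\<bar> powr p * thin_weight p x) \<partial>lebesgue)
      \<le> (\<integral>\<^sup>+x. (\<Sum>k\<in>{2..<n + 2}. indicator {2 ^ k..2 ^ k + 1 :: real} x) \<partial>lebesgue)"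
  proof (rule nn_integral_mono)
    fix x :: real
    show "ennreal (\<bar>staircase n x\<bar> powr p * thin_weight p x)
        \<le> (\<Sum>k\<in>{2..<n + 2}. indicator {2 ^ k..2 ^ k + 1} x)"
    proof (cases "\<exists>k\<in>{2..<n + 2}. x \<in> {2 ^ k..2 ^ k + 1}")
      case True
      then obtain k where k: "k \<in> {2..<n + 2}" "x \<in> {2 ^ k..2 ^ k + 1}" by blast
      have x: "x \<in> thin_set" using k unfolding thin_set_def by blast
      have "\<bar>staircase n x\<bar> powr p * thin_weight p x \<le> x powr p * x powr (- p)"
        using k p x by (auto simp: staircase_eq[OF k] thin_weight_def intro!: mult_right_mono powr_mono2)
      also have "\<dots> = 1" using thin_set_ge_1[OF x] by (simp add: powr_add[symmetric])
      finally have "ennreal (\<bar>staircase n x\<bar> powr p * thin_weight p x) \<le> indicator {2 ^ k..2 ^ k + 1} x"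
        using k by simp
      also have "\<dots> \<le> (\<Sum>k\<in>{2..<n + 2}. indicator {2 ^ k..2 ^ k + 1} x)"
        using k by (intro member_le_sum) auto
      finally show ?thesis .
    next
      case False
      hence "staircase n x = 0" unfolding staircase_def by (intro sum.neutral) auto
      thus ?thesis by simp
    qed
  qed
  also have "\<dots> = (\<Sum>k\<in>{2..<n + 2}. 1)"
    by (subst nn_integral_sum) auto
  also have "\<dots> = ennreal (real n)" by (simp add: ennreal_of_nat_eq_real_of_nat)
  finally show ?thesis .
qed

lemma staircase_in_Lp_space:
  assumes p: "1 < p"
  shows "staircase n \<in> Lp_space p (thin_weight p)"
proof -
  have "staircase n \<in> borel_measurable lebesgue" using staircase_integrable by auto
  moreover have "staircase n x = 0" if "thin_weight p x = 0" for x
  proof -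
    have "x \<notin> thin_set" using that thin_set_ge_1[of x] by (auto simp: thin_weight_def)
    thus ?thesis unfolding staircase_def by (intro sum.neutral) (auto simp: thin_set_def)
  qed
  moreover have "(\<integral>\<^sup>+x. ennreal (\<bar>staircase n x\<bar> powr p * thin_weight p x) \<partial>lebesgue) < \<infinity>"
    using staircase_thin_norm[OF p, of n] by (simp add: le_less_trans)
  ultimately show ?thesis by (simp add: Lp_space_def)
qed

lemma staircase_hilbert_thin_norm:
  assumes p: "1 < p"
  shows "ennreal (real n / 2) \<le> Lp_norm p (thin_weight p) (\<lambda>x. ennreal \<bar>hilbert_transform (staircase n) x\<bar>)"
proof -
  let ?c = "real n powr p * 2 powr (- p)"
  have "ennreal ?c = (\<integral>\<^sup>+x. ennreal ?c * indicator {1..2::real} x \<partial>lebesgue)"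
    by (simp add: nn_integral_cmult_indicator)
  also have "\<dots> \<le> (\<integral>\<^sup>+x. ennreal (\<bar>hilbert_transform (staircase n) x\<bar> powr p * thin_weight p x) \<partial>lebesgue)"
  proof (rule nn_integral_mono)
    fix x :: real
    show "ennreal ?c * indicator {1..2} x \<le> ennreal (\<bar>hilbert_transform (staircase n) x\<bar> powr p * thin_weight p x)"
    proof (cases "x \<in> {1..2}")
      case x: True
      hence u: "thin_weight p x = x powr (- p)"
        using first_block_subset_thin_set by (auto simp: thin_weight_def)
      have "?c \<le> \<bar>hilbert_transform (staircase n) x\<bar> powr p * x powr (- p)"
        using x p staircase_hilbert_transform_ge[of x n]
        by (intro mult_mono powr_mono2 powr_mono2') auto
      thus ?thesis using x u by (simp add: ennreal_leI)
    qed simp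
  qed
  finally have "ennpowr (ennreal ?c) (1 / p) \<le> Lp_norm p (thin_weight p) (\<lambda>x. ennreal \<bar>hilbert_transform (staircase n) x\<bar>)"
    unfolding Lp_norm_abs[OF thin_weight_nonneg] using p by (intro ennpowr_mono) auto
  moreover have "ennpowr (ennreal ?c) (1 / p) = ennreal (real n / 2)"
  proof -
    have "?c powr (1 / p) = real n / 2"
    proof -
      have "?c powr (1 / p) = real n powr (p * (1 / p)) * 2 powr (- p * (1 / p))"
        by (simp only: powr_mult powr_powr)
      thus ?thesis using p by (simp add: powr_minus_divide)
    qed
    thus ?thesis by (simp add: ennpowr_ennreal)
  qed
  ultimately show ?thesis by simp
qed

text \<open>The norm of a staircase grows at most like \<open>n powr (1 / p)\<close>, that of its Hilbert transform at
  least like \<open>n\<close>.\<close>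

lemma not_hilbert_bounded_thin_weight:
  assumes p: "1 < p"
  shows "\<not> hilbert_bounded p (thin_weight p)"
proof
  assume "hilbert_bounded p (thin_weight p)"
  then obtain C where C: "0 \<le> C" and bd: "\<And>f. f \<in> Lp_space p (thin_weight p) \<Longrightarrow>
     (AE x in lebesgue. 0 < thin_weight p x \<longrightarrow> (\<exists>h. has_hilbert_transform f x h)) \<Longrightarrow>
     Lp_norm p (thin_weight p) (\<lambda>x. ennreal \<bar>hilbert_transform f x\<bar>)
       \<le> ennreal C * Lp_norm p (thin_weight p) (\<lambda>x. ennreal \<bar>f x\<bar>)"
    unfolding hilbert_bounded_def by blast
  have ineq: "real n / 2 \<le> C * real n powr (1 / p)" for n
  proof -
    have "ennreal (real n / 2) \<le> ennreal C * Lp_norm p (thin_weight p) (\<lambda>x. ennreal \<bar>staircase n x\<bar>)"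
      using staircase_has_hilbert_transform[of n]
      by (intro order_trans[OF staircase_hilbert_thin_norm[OF p] bd] staircase_in_Lp_space p) (auto elim!: eventually_mono)
    also have "\<dots> \<le> ennreal C * ennpowr (ennreal (real n)) (1 / p)"
      unfolding Lp_norm_abs[OF thin_weight_nonneg]
      using p by (intro mult_left_mono ennpowr_mono staircase_thin_norm) auto
    also have "\<dots> = ennreal (C * real n powr (1 / p))"
      using C by (simp add: ennpowr_ennreal ennreal_mult)
    finally show ?thesis using C by simp
  qed
  define a where "a = 1 - 1 / p"
  have a: "0 < a" using p by (simp add: a_def)
  obtain n where n: "(2 * C + 1) powr (1 / a) < real n" using reals_Archimedean2 by blast
  have n0: "0 < real n" using n by (rule le_less_trans[rotated]) simp
  have "2 * C + 1 = ((2 * C + 1) powr (1 / a)) powr a" using a C by (simp add: powr_powr)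
  also have "\<dots> \<le> real n powr a" using n a by (intro powr_mono2) auto
  also have "\<dots> = real n / real n powr (1 / p)" using n0 by (simp add: a_def powr_diff)
  also have "\<dots> \<le> 2 * C" using ineq[of n] n0 by (simp add: divide_simps mult_ac)
  finally show False by simp
qed

theorem theorem1p5:
  fixes p :: real
  assumes "1 < p"
  shows "\<exists>u :: real \<Rightarrow> real. nontrivial_weight u \<and> maximal_bounded p u \<and> \<not> hilbert_bounded p u"
  using nontrivial_thin_weight maximal_bounded_thin_weight not_hilbert_bounded_thin_weight assms
  by blast

end
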